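(* For every integer $\nu\ge0$: (i) $$(2\nu+1)+\sum_{m=2}^{\nu+1}\sum_{l=1}^{\nu}(2l-1)\binom{\nu+m-l-1}{2m-3}=\sum_{m=0}^{\nu}\frac{2\nu+1}{2\nu+1-m}\binom{2\nu+1-m}{m};$$ (ii) $$\nu+\sum_{m=2}^{\nu}\sum_{l=1}^{\nu-1}l\binom{\nu+m-l-2}{2m-3}=\sum_{m=1}^{\nu}\binom{\nu+m-1}{2m-1}.$$
   Context: Binomial coefficients $\binom{n}{k}$ with $0\le n<k$ are $0$, and empty sums are $0$. *)

theory Defs
  imports Complex_Main
begin

end

theory Submission
  imports Defs
begin

text \<open>
  Fix \<open>m \<ge> 2\<close>. As \<open>l\<close> runs upwards, the upper index of the binomial coefficients in the
  inner sums runs down to \<open>m - 1\<close>, which does not exceed the lower index \<open>2 * m - 3\<close>; all terms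
  with larger \<open>l\<close> would vanish. The inner sums are therefore complete, and the hockey-stick
  identity (\<open>sum_descending_choose\<close>) and its iterate (\<open>weighted_sum_descending_choose\<close>) evaluate
  them in closed form. The summand outside the double sum is the value of that closed form at
  \<open>m = 1\<close>.

  In (ii) the inner sum is exactly the summand of index \<open>m\<close> on the right. In (i) it is
  \<open>2 * C(\<nu>+m, 2m-1) - C(\<nu>+m-1, 2m-2)\<close>. By the absorption identity this equals
  \<open>(2\<nu>+1)/(\<nu>+m) * C(\<nu>+m, 2m-1)\<close> (\<open>lucas_summand_eq\<close>), and the substitution
  \<open>m \<mapsto> \<nu>+1-m\<close> together with the symmetry of binomial coefficients turns it into the summand
  on the right.
\<close>

text \<open>The hockey-stick identity. The condition \<open>k \<le> p\<close> says that the sum stops only after all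
  nonzero terms of its column have been collected.\<close>

lemma sum_descending_choose:
  assumes "k \<le> p"
  shows "(\<Sum>l=1..n. (n + k - l) choose p) = (n + k) choose Suc p"
proof (induction n)
  case 0
  show ?case using assms by (simp add: binomial_eq_0)
next
  case (Suc n)
  have "(\<Sum>l=1..Suc n. (Suc n + k - l) choose p)
      = (n + k choose p) + (\<Sum>l=1..n. (n + k - l) choose p)"
    by (subst sum.atLeast_Suc_atMost, simp, subst sum.shift_bounds_cl_Suc_ivl) simp
  with Suc show ?case by simp
qed

text \<open>The weight \<open>l\<close> amounts to summing the hockey-stick identity once more: shifting \<open>l\<close> by one
  splits off an unweighted sum, and Pascal's rule merges the pieces.\<close>

lemma weighted_sum_descending_choose:
  assumes "k \<le> p"
  shows "(\<Sum>l=1..n. l * ((n + k - l) choose p)) = Suc (n + k) choose Suc (Suc p)"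
proof (induction n)
  case 0
  show ?case using assms by (simp add: binomial_eq_0)
next
  case (Suc n)
  have "(\<Sum>l=1..Suc n. l * ((Suc n + k - l) choose p))
      = (n + k choose p) + (\<Sum>l=1..n. Suc l * ((n + k - l) choose p))"
    by (subst sum.atLeast_Suc_atMost, simp, subst sum.shift_bounds_cl_Suc_ivl) simp
  also have "(\<Sum>l=1..n. Suc l * ((n + k - l) choose p))
      = (\<Sum>l=1..n. (n + k - l) choose p) + (\<Sum>l=1..n. l * ((n + k - l) choose p))"
    by (simp add: sum.distrib)
  finally show ?case
    using Suc sum_descending_choose[OF assms, of n] by simp
qed

text \<open>Splitting \<open>2n+1 = 2(n+j+1) - (2j+1)\<close> and absorbing the factor \<open>2j+1\<close> into the binomial
  coefficient shows that the fractional coefficient hides an integer. Summed over \<open>j\<close>, both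
  sides give the Lucas number of index \<open>2n+1\<close>.\<close>

lemma lucas_summand_eq:
  fixes n j :: nat
  shows "(2 * real n + 1) / real (n + j + 1) * real ((n + j + 1) choose (2 * j + 1))
       = 2 * real ((n + j + 1) choose (2 * j + 1)) - real ((n + j) choose (2 * j))"
proof -
  have "(2 * j + 1) * ((n + j + 1) choose (2 * j + 1)) = (n + j + 1) * ((n + j) choose (2 * j))"
    using Suc_times_binomial_eq[of "n + j" "2 * j"] by (simp add: mult.commute)
  from arg_cong[OF this, of real]
  have "(2 * real j + 1) * real ((n + j + 1) choose (2 * j + 1))
      = real (n + j + 1) * real ((n + j) choose (2 * j))"
    by (simp only: of_nat_mult) (simp add: add_ac)
  then show ?thesis
    by (simp add: field_simps)
qed

theorem theorem6p1:
  fixes \<nu> :: nat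
  shows "(2 * real \<nu> + 1) +
           (\<Sum>m=2..\<nu>+1. \<Sum>l=1..\<nu>. (2 * real l - 1) * real ((\<nu> + m - l - 1) choose (2 * m - 3)))
         = (\<Sum>m=0..\<nu>. (2 * real \<nu> + 1) / (2 * real \<nu> + 1 - real m) * real ((2 * \<nu> + 1 - m) choose m))
       \<and> \<nu> + (\<Sum>m=2..\<nu>. \<Sum>l=1..\<nu>-1. l * ((\<nu> + m - l - 2) choose (2 * m - 3)))
         = (\<Sum>m=1..\<nu>. (\<nu> + m - 1) choose (2 * m - 1))"
proof (rule conjI, goal_cases)
  case 1
  define A where "A m = 2 * real ((\<nu> + m) choose (2 * m - 1)) - real ((\<nu> + m - 1) choose (2 * m - 2))"
    for m
  have inner: "(\<Sum>l=1..\<nu>. (2 * real l - 1) * real ((\<nu> + m - l - 1) choose (2 * m - 3))) = A m"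
    if "m \<ge> 2" for m
  proof -
    obtain i where m: "m = i + 2"
      using le_Suc_ex[OF \<open>m \<ge> 2\<close>] by (auto simp: add.commute)
    have "(\<Sum>l=1..\<nu>. (2 * real l - 1) * real ((\<nu> + m - l - 1) choose (2 * m - 3)))
        = 2 * real (\<Sum>l=1..\<nu>. l * ((\<nu> + (i + 1) - l) choose (2 * i + 1)))
          - real (\<Sum>l=1..\<nu>. (\<nu> + (i + 1) - l) choose (2 * i + 1))"
      by (simp add: m algebra_simps sum_subtractf sum_distrib_left)
    also have "\<dots> = A m"
      by (simp only: weighted_sum_descending_choose[of "i + 1" "2 * i + 1" \<nu>]
          sum_descending_choose[of "i + 1" "2 * i + 1" \<nu>]) (simp add: A_def m)
    finally show ?thesis .
  qed
  have "(2 * real \<nu> + 1) +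
      (\<Sum>m=2..\<nu>+1. \<Sum>l=1..\<nu>. (2 * real l - 1) * real ((\<nu> + m - l - 1) choose (2 * m - 3)))
      = A 1 + (\<Sum>m=2..\<nu>+1. A m)"
  proof (rule arg_cong2[of _ _ _ _ "(+)"])
    show "2 * real \<nu> + 1 = A 1"
      by (simp add: A_def)
  qed (rule sum.cong[OF refl], rule inner, simp)
  also have "\<dots> = (\<Sum>m=1..\<nu>+1. A m)"
    by (subst (2) sum.atLeast_Suc_atMost) (simp_all add: numeral_2_eq_2)
  also have "\<dots> = (\<Sum>j=0..\<nu>. A (j + 1))"
    using sum.shift_bounds_cl_Suc_ivl[of A 0 \<nu>] by simp
  also have "\<dots> = (\<Sum>m=0..\<nu>. A (\<nu> - m + 1))"
    using sum.atLeastAtMost_rev[of "\<lambda>j. A (j + 1)" 0 \<nu>] by simp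
  also have "\<dots> = (\<Sum>m=0..\<nu>. (2 * real \<nu> + 1) / (2 * real \<nu> + 1 - real m)
                        * real ((2 * \<nu> + 1 - m) choose m))"
  proof (rule sum.cong[OF refl])
    fix m assume "m \<in> {0..\<nu>}"
    then obtain j where j: "\<nu> = m + j"
      using le_Suc_ex by auto
    have "(\<nu> + j + 1) choose (2 * j + 1) = (2 * \<nu> + 1 - m) choose m"
      using binomial_symmetric[of m "2 * \<nu> + 1 - m"] by (simp add: j mult_2 add_ac)
    moreover have "real (\<nu> + j + 1) = 2 * real \<nu> + 1 - real m"
      by (simp add: j)
    ultimately show "A (\<nu> - m + 1) = (2 * real \<nu> + 1) / (2 * real \<nu> + 1 - real m)
                        * real ((2 * \<nu> + 1 - m) choose m)"
      using lucas_summand_eq[of \<nu> j] by (simp add: A_def j add_ac)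
  qed
  finally show ?case .
next
  case 2
  show ?case
  proof (cases "\<nu> = 0")
    case False
    have inner: "(\<Sum>l=1..\<nu>-1. l * ((\<nu> + m - l - 2) choose (2 * m - 3)))
        = (\<nu> + m - 1) choose (2 * m - 1)" if "m \<ge> 2" for m
    proof -
      obtain i where m: "m = i + 2"
        using le_Suc_ex[OF \<open>m \<ge> 2\<close>] by (auto simp: add.commute)
      obtain n where n: "\<nu> = Suc n"
        using False not0_implies_Suc by blast
      show ?thesis
        using weighted_sum_descending_choose[of "i + 1" "2 * i + 1" n] by (simp add: m n)
    qed
    have "(\<Sum>m=2..\<nu>. \<Sum>l=1..\<nu>-1. l * ((\<nu> + m - l - 2) choose (2 * m - 3)))
        = (\<Sum>m=2..\<nu>. (\<nu> + m - 1) choose (2 * m - 1))"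
      by (rule sum.cong[OF refl], rule inner, simp)
    moreover have "(\<Sum>m=1..\<nu>. (\<nu> + m - 1) choose (2 * m - 1))
        = \<nu> + (\<Sum>m=2..\<nu>. (\<nu> + m - 1) choose (2 * m - 1))"
      using False by (subst sum.atLeast_Suc_atMost) (simp_all add: numeral_2_eq_2)
    ultimately show ?thesis
      by (simp only:)
  qed simp
qed

end
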